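(* Let $M$ be a non-zero left $R$-module which is an S-IAD-module. The following are equivalent: (1) $\mathrm{Spec}^{\mathrm{fc}}(M)=\mathcal{S}(M)$; (2) $\mathbf{Z}^{\mathrm{fc}}(M)$ is discrete; (3) $\mathbf{Z}^{\mathrm{fc}}(M)$ is $T_2$ (Hausdorff); (4) $\mathbf{Z}^{\mathrm{fc}}(M)$ is $T_1$.
   Context: $R$ is an associative (not necessarily commutative) ring with $1_R\neq 0_R$ and modules are unital left $R$-modules; $L\leq_R M$ means that $L$ is an $R$-submodule of $M$. A submodule $L\leq_R M$ is fully invariant if $f(L)\subseteq L$ for every $R$-linear endomorphism $f$ of $M$; $M$ is duo if every $R$-submodule of $M$ is fully invariant. $M$ is self-injective if for every $N\leq_R M$ every $R$-linear map $N\to M$ extends to an endomorphism of $M$. $M$ is atomic if every non-zero submodule of $M$ contains a simple submodule. An S-IAD-module is a module that is self-injective, atomic and duo. $\mathcal{S}(M)$ is the set of simple submodules of $M$. For $X,Y\leq_R M$ put $\mathrm{An}(X)=\{f\in \mathrm{End}_R(M)\mid f(X)=0\}$ and $X\odot_M Y=\bigcap_{f\in\mathrm{An}(X)} f^{-1}(Y)$. A non-zero fully invariant submodule $K$ of $M$ is fully coprime in $M$ if for all fully invariant submodules $X,Y$ of $M$: $K\subseteq X\odot_M Y$ implies $K\subseteq X$ or $K\subseteq Y$. $\mathrm{Spec}^{\mathrm{fc}}(M)$ is the set of all non-zero fully invariant submodules of $M$ that are fully coprime in $M$. For $M$ duo, $\mathbf{Z}^{\mathrm{fc}}(M)$ is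 $\mathrm{Spec}^{\mathrm{fc}}(M)$ with the topology whose closed sets are $\mathcal{V}^{\mathrm{fc}}(L)=\{K\in\mathrm{Spec}^{\mathrm{fc}}(M)\mid K\subseteq L\}$, $L\leq_R M$. *)

theory Defs
  imports "HOL-Analysis.Analysis"
begin

text \<open>
  Unital left modules over an arbitrary, possibly noncommutative, ring. The ring \<open>R\<close> is the type
  \<open>'r\<close> and the module \<open>M\<close> is the type \<open>'m\<close>; the class \<^class>\<open>ring_1\<close> includes \<open>1 \<noteq> 0\<close>. The locales
  \<open>module\<close> of HOL and of HOL-Algebra are restricted to commutative scalars.
\<close>

locale left_module =
  fixes scale :: "'r::ring_1 \<Rightarrow> 'm::ab_group_add \<Rightarrow> 'm" (infixr \<open>*l\<close> 75)
  assumes scale_right_distrib: "a *l (x + y) = a *l x + a *l y"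
    and scale_left_distrib: "(a + b) *l x = a *l x + b *l x"
    and scale_scale: "a *l (b *l x) = (a * b) *l x"
    and scale_one: "1 *l x = x"
begin

definition submodule :: "'m set \<Rightarrow> bool" where
  "submodule N \<longleftrightarrow> 0 \<in> N \<and> (\<forall>x\<in>N. \<forall>y\<in>N. x + y \<in> N) \<and> (\<forall>r. \<forall>x\<in>N. r *l x \<in> N)"

text \<open>\<open>R\<close>-linear maps \<open>N \<rightarrow> M\<close> are functions on \<open>'m\<close> whose values outside \<open>N\<close> are irrelevant.\<close>

definition hom_on :: "'m set \<Rightarrow> ('m \<Rightarrow> 'm) \<Rightarrow> bool" where
  "hom_on N f \<longleftrightarrow>
     (\<forall>x\<in>N. \<forall>y\<in>N. f (x + y) = f x + f y) \<and> (\<forall>r. \<forall>x\<in>N. f (r *l x) = r *l f x)"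

definition End :: "('m \<Rightarrow> 'm) set" where
  "End = {f. hom_on UNIV f}"

definition fully_invariant :: "'m set \<Rightarrow> bool" where
  "fully_invariant L \<longleftrightarrow> submodule L \<and> (\<forall>f\<in>End. f ` L \<subseteq> L)"

definition duo :: bool where
  "duo \<longleftrightarrow> (\<forall>L. submodule L \<longrightarrow> fully_invariant L)"

definition self_injective :: bool where
  "self_injective \<longleftrightarrow>
     (\<forall>N f. submodule N \<and> hom_on N f \<longrightarrow> (\<exists>g\<in>End. \<forall>x\<in>N. g x = f x))"

definition simple_submodule :: "'m set \<Rightarrow> bool" where
  "simple_submodule S \<longleftrightarrow>
     submodule S \<and> S \<noteq> {0} \<and> (\<forall>N. submodule N \<and> N \<subseteq> S \<longrightarrow> N = {0} \<or> N = S)"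

definition simples :: "'m set set" where
  "simples = {S. simple_submodule S}"

definition atomic :: bool where
  "atomic \<longleftrightarrow> (\<forall>N. submodule N \<and> N \<noteq> {0} \<longrightarrow> (\<exists>S. simple_submodule S \<and> S \<subseteq> N))"

definition S_IAD :: bool where
  "S_IAD \<longleftrightarrow> self_injective \<and> atomic \<and> duo"

definition An :: "'m set \<Rightarrow> ('m \<Rightarrow> 'm) set" where
  "An X = {f\<in>End. f ` X \<subseteq> {0}}"

definition coprod :: "'m set \<Rightarrow> 'm set \<Rightarrow> 'm set" (infixl \<open>\<odot>\<close> 70) where
  "X \<odot> Y = (\<Inter>f\<in>An X. f -` Y)"

definition fully_coprime :: "'m set \<Rightarrow> bool" where
  "fully_coprime K \<longleftrightarrow> fully_invariant K \<and> K \<noteq> {0} \<and>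
     (\<forall>X Y. fully_invariant X \<and> fully_invariant Y \<longrightarrow> K \<subseteq> X \<odot> Y \<longrightarrow> K \<subseteq> X \<or> K \<subseteq> Y)"

definition Spec_fc :: "'m set set" where
  "Spec_fc = {K. fully_coprime K}"

definition V_fc :: "'m set \<Rightarrow> 'm set set" where
  "V_fc L = {K \<in> Spec_fc. K \<subseteq> L}"

text \<open>
  The function \<^const>\<open>topology\<close> is only meaningful on families satisfying \<^const>\<open>istopology\<close>. For
  duo \<open>M\<close> this holds, and the closed sets are exactly the \<open>V_fc L\<close>; both are proved below.
\<close>

definition Z_fc :: "'m set topology" where
  "Z_fc = topology (\<lambda>U. \<exists>L. submodule L \<and> U = Spec_fc - V_fc L)"

lemma submodule_UNIV: "submodule UNIV"
  by (simp add: submodule_def)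

lemma submodule_zero: "submodule {0}"
proof -
  have "r *l 0 = 0" for r
    using scale_right_distrib[of r 0 0] by simp
  then show ?thesis by (simp add: submodule_def)
qed

lemma submodule_Inter: "(\<And>L. L \<in> \<L> \<Longrightarrow> submodule L) \<Longrightarrow> submodule (\<Inter>\<L>)"
  by (auto simp: submodule_def)

lemma End_zero: "f \<in> End \<Longrightarrow> f 0 = 0"
proof -
  assume "f \<in> End"
  then have "f (0 + 0) = f 0 + f 0"
    unfolding End_def hom_on_def by blast
  then show "f 0 = 0" by simp
qed

lemma submodule_coprod:
  assumes "submodule Y"
  shows "submodule (X \<odot> Y)"
proof -
  have "f 0 \<in> Y" if "f \<in> An X" for f
    using that assms End_zero[of f] by (simp add: submodule_def An_def)
  then show ?thesis
    using assms by (auto simp: submodule_def coprod_def An_def End_def hom_on_def)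
qed

lemma V_fc_zero: "V_fc {0} = {}"
  by (auto simp: V_fc_def Spec_fc_def fully_coprime_def fully_invariant_def submodule_def)

lemma V_fc_UNIV: "V_fc UNIV = Spec_fc"
  by (auto simp: V_fc_def)

lemma V_fc_Un:
  assumes duo "submodule X" "submodule Y"
  shows "V_fc X \<union> V_fc Y = V_fc (X \<odot> Y)"
proof -
  have fi: "fully_invariant X" "fully_invariant Y"
    using assms by (auto simp: duo_def)
  have "X \<subseteq> X \<odot> Y"
    using assms(3) by (fastforce simp: coprod_def An_def submodule_def)
  moreover have "Y \<subseteq> X \<odot> Y"
    using fi(2) by (fastforce simp: coprod_def An_def fully_invariant_def)
  moreover have "K \<subseteq> X \<or> K \<subseteq> Y" if "K \<in> Spec_fc" "K \<subseteq> X \<odot> Y" for K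
    using that fi by (simp add: Spec_fc_def fully_coprime_def)
  ultimately show ?thesis
    by (auto simp: V_fc_def)
qed

lemma istopology_Z_fc:
  assumes duo
  shows "istopology (\<lambda>U. \<exists>L. submodule L \<and> U = Spec_fc - V_fc L)"
  unfolding istopology_def
proof (intro conjI allI impI)
  fix S T
  assume "\<exists>L. submodule L \<and> S = Spec_fc - V_fc L" "\<exists>L. submodule L \<and> T = Spec_fc - V_fc L"
  then obtain X Y where XY: "submodule X" "S = Spec_fc - V_fc X"
      "submodule Y" "T = Spec_fc - V_fc Y"
    by blast
  then have "S \<inter> T = Spec_fc - V_fc (X \<odot> Y)"
    using V_fc_Un[OF assms XY(1,3)] by auto
  then show "\<exists>L. submodule L \<and> S \<inter> T = Spec_fc - V_fc L"
    using submodule_coprod[OF XY(3)] by blast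
next
  fix \<K>
  assume "\<forall>K\<in>\<K>. \<exists>L. submodule L \<and> K = Spec_fc - V_fc L"
  then obtain l where l: "\<And>K. K \<in> \<K> \<Longrightarrow> submodule (l K)"
      "\<And>K. K \<in> \<K> \<Longrightarrow> K = Spec_fc - V_fc (l K)"
    by metis
  have "\<Union>\<K> = (\<Union>K\<in>\<K>. Spec_fc - V_fc (l K))"
    using l(2) by auto
  also have "\<dots> = Spec_fc - V_fc (\<Inter>(l ` \<K>))"
    by (auto simp: V_fc_def)
  finally show "\<exists>L. submodule L \<and> \<Union>\<K> = Spec_fc - V_fc L"
    using submodule_Inter[of "l ` \<K>"] l(1) by blast
qed

lemma openin_Z_fc:
  assumes duo
  shows "openin Z_fc U \<longleftrightarrow> (\<exists>L. submodule L \<and> U = Spec_fc - V_fc L)"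
  using istopology_Z_fc[OF assms] by (simp add: Z_fc_def)

lemma topspace_Z_fc:
  assumes duo
  shows "topspace Z_fc = Spec_fc"
proof
  show "topspace Z_fc \<subseteq> Spec_fc"
    using openin_topspace[of Z_fc] unfolding openin_Z_fc[OF assms] by blast
  have "openin Z_fc Spec_fc"
    unfolding openin_Z_fc[OF assms] using submodule_zero V_fc_zero by auto
  then show "Spec_fc \<subseteq> topspace Z_fc"
    by (rule openin_subset)
qed

lemma closedin_Z_fc:
  assumes duo
  shows "closedin Z_fc C \<longleftrightarrow> (\<exists>L. submodule L \<and> C = V_fc L)"
proof -
  have "V_fc L \<subseteq> Spec_fc" for L
    by (auto simp: V_fc_def)
  then show ?thesis
    unfolding closedin_def topspace_Z_fc[OF assms] openin_Z_fc[OF assms]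
    by (metis double_diff order_refl)
qed

end

end

theory Submission
  imports Defs
begin

text \<open>
  Discrete spaces are Hausdorff and Hausdorff spaces are \<open>T\<^sub>1\<close>, so two implications
  carry the theorem. Both rest on the fact that simple submodules are always points of the
  spectrum (\<open>simple_imp_fully_coprime\<close>): if \<open>K\<close> is simple and not contained in \<open>X\<close>, then
  \<open>X + K\<close> is a direct sum, and by self-injectivity the projection onto \<open>K\<close> extends to an
  endomorphism of \<open>M\<close> that kills \<open>X\<close> and fixes \<open>K\<close> pointwise; hence \<open>K \<subseteq> X \<odot> Y\<close>
  forces \<open>K \<subseteq> Y\<close>.

  If the space is \<open>T\<^sub>1\<close> and \<open>K\<close> is a point, choose by atomicity a simple \<open>S \<subseteq> K\<close>. Then
  \<open>S\<close> is a point that lies in every closed set containing \<open>K\<close>, in particular in \<open>{K}\<close>;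
  so \<open>K = S\<close> is simple.

  If conversely all points are simple, then every set \<open>A\<close> of points is closed
  (\<open>all_points_simple_imp_V_fc_exhausts\<close>). The natural candidate \<open>A = V_fc (\<Sum>A)\<close> would
  require decompositions of elements of a sum; instead, take \<open>L\<close> maximal with
  \<open>V_fc L \<subseteq> A\<close>. Such an \<open>L\<close> exists by Zorn's lemma, since a simple module contained in the
  union of a chain is already contained in a member. Adding a point \<open>S \<in> A\<close> to
  \<open>V_fc L\<close> by passing to \<open>L \<odot> S\<close> does not leave \<open>A\<close>, so maximality gives \<open>S \<subseteq> L\<close>.
\<close>

context left_module
begin

section \<open>Submodules\<close>

lemma submodule_add: "submodule N \<Longrightarrow> x \<in> N \<Longrightarrow> y \<in> N \<Longrightarrow> x + y \<in> N"
  by (simp add: submodule_def)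

lemma submodule_scale: "submodule N \<Longrightarrow> x \<in> N \<Longrightarrow> r *l x \<in> N"
  by (simp add: submodule_def)

lemma submodule_0: "submodule N \<Longrightarrow> 0 \<in> N"
  by (simp add: submodule_def)

lemma scale_minus_one: "(- 1) *l x = - x"
proof -
  have "0 *l x = 0"
    using scale_left_distrib[of 0 0 x] by simp
  then have "(- 1) *l x + x = 0"
    using scale_left_distrib[of "- 1" 1 x] scale_one[of x] by simp
  then show ?thesis
    by (simp add: eq_neg_iff_add_eq_0)
qed

lemma submodule_diff:
  assumes "submodule N" "x \<in> N" "y \<in> N"
  shows "x - y \<in> N"
  using submodule_add[OF assms(1,2) submodule_scale[OF assms(1,3), of "- 1"]]
  by (simp add: scale_minus_one)

lemma scale_right_diff: "r *l (x - y) = r *l x - r *l y"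
  using scale_right_distrib[of r "x - y" y] by simp

lemma submodule_Int: "submodule X \<Longrightarrow> submodule Y \<Longrightarrow> submodule (X \<inter> Y)"
  by (simp add: submodule_def)

lemma submodule_sum:
  assumes X: "submodule X" and Y: "submodule Y"
  shows "submodule {x + y |x y. x \<in> X \<and> y \<in> Y}"
  unfolding submodule_def
proof (intro conjI ballI allI)
  show "0 \<in> {x + y |x y. x \<in> X \<and> y \<in> Y}"
    using submodule_0[OF X] submodule_0[OF Y] by force
next
  fix u v
  assume "u \<in> {x + y |x y. x \<in> X \<and> y \<in> Y}" "v \<in> {x + y |x y. x \<in> X \<and> y \<in> Y}"
  then obtain x y x' y' where "u = x + y" "v = x' + y'" and in_XY: "x \<in> X" "y \<in> Y" "x' \<in> X" "y' \<in> Y"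
    by blast
  then have "u + v = (x + x') + (y + y')"
    by (simp add: algebra_simps)
  then show "u + v \<in> {x + y |x y. x \<in> X \<and> y \<in> Y}"
    using in_XY submodule_add[OF X] submodule_add[OF Y] by blast
next
  fix r u
  assume "u \<in> {x + y |x y. x \<in> X \<and> y \<in> Y}"
  then show "r *l u \<in> {x + y |x y. x \<in> X \<and> y \<in> Y}"
    using submodule_scale[OF X] submodule_scale[OF Y] scale_right_distrib by blast
qed

lemma submodule_chain_Union:
  assumes "\<C> \<noteq> {}" "\<And>N. N \<in> \<C> \<Longrightarrow> submodule N"
    and "\<And>N N'. N \<in> \<C> \<Longrightarrow> N' \<in> \<C> \<Longrightarrow> N \<subseteq> N' \<or> N' \<subseteq> N"
  shows "submodule (\<Union>\<C>)"
  unfolding submodule_def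
proof (intro conjI ballI allI)
  show "0 \<in> \<Union>\<C>"
    using assms(1,2) submodule_0 by blast
next
  fix x y
  assume "x \<in> \<Union>\<C>" "y \<in> \<Union>\<C>"
  then obtain N where "N \<in> \<C>" "x \<in> N" "y \<in> N"
    using assms(3) by blast
  then show "x + y \<in> \<Union>\<C>"
    using assms(2) submodule_add by blast
next
  fix r x
  assume "x \<in> \<Union>\<C>"
  then show "r *l x \<in> \<Union>\<C>"
    using assms(2) submodule_scale by blast
qed

text \<open>
  Simplicity turns containment into a condition on a single non-zero element.
\<close>

lemma simple_subset_iff_meets:
  assumes "simple_submodule K" "submodule X"
  shows "K \<subseteq> X \<longleftrightarrow> K \<inter> X \<noteq> {0}"
proof
  assume "K \<subseteq> X"
  then show "K \<inter> X \<noteq> {0}"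
    using assms(1) by (simp add: simple_submodule_def Int_absorb2)
next
  assume "K \<inter> X \<noteq> {0}"
  moreover have "submodule (K \<inter> X)"
    using assms submodule_Int by (simp add: simple_submodule_def)
  ultimately have "K \<inter> X = K"
    using assms(1) unfolding simple_submodule_def by (metis Int_lower1)
  then show "K \<subseteq> X"
    by (simp add: inf.absorb_iff1)
qed

section \<open>Simple submodules are fully coprime\<close>

text \<open>
  Self-injectivity is used only through this consequence: on \<open>X + K\<close> the projection
  onto \<open>K\<close> is well defined, and it extends to all of \<open>M\<close>.
\<close>

lemma self_injective_extends_projection:
  assumes inj: self_injective and X: "submodule X" and K: "submodule K" and disj: "K \<inter> X = {0}"
  shows "\<exists>g\<in>An X. \<forall>k\<in>K. g k = k"
proof -
  define p where "p m = (THE k. k \<in> K \<and> m - k \<in> X)" for m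
  \<comment> \<open>Two candidates for \<open>p m\<close> differ by an element of \<open>K \<inter> X\<close>, so the choice is unique.\<close>
  have p_eq: "p m = k" if "k \<in> K" "m - k \<in> X" for m k
    unfolding p_def
  proof (rule the_equality)
    show "k \<in> K \<and> m - k \<in> X"
      using that by simp
  next
    fix k'
    assume k': "k' \<in> K \<and> m - k' \<in> X"
    have "k - k' \<in> K"
      using submodule_diff[OF K] that k' by blast
    moreover have "k - k' \<in> X"
      using submodule_diff[OF X, of "m - k'" "m - k"] that k' by simp
    ultimately have "k - k' \<in> {0}"
      unfolding disj[symmetric] by (rule IntI)
    then show "k' = k"
      by simp
  qed
  let ?N = "{x + k |x k. x \<in> X \<and> k \<in> K}"
  have p_in: "p m \<in> K \<and> m - p m \<in> X" if "m \<in> ?N" for m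
  proof -
    from that obtain x k where "m = x + k" "x \<in> X" "k \<in> K"
      by blast
    then show ?thesis
      using p_eq[of k m] by simp
  qed
  have "hom_on ?N p"
    unfolding hom_on_def
  proof (intro conjI ballI allI)
    fix m m'
    assume m: "m \<in> ?N" "m' \<in> ?N"
    have "(m - p m) + (m' - p m') \<in> X"
      using submodule_add[OF X] p_in[OF m(1)] p_in[OF m(2)] by blast
    also have "(m - p m) + (m' - p m') = (m + m') - (p m + p m')"
      by (simp add: algebra_simps)
    finally have "(m + m') - (p m + p m') \<in> X" .
    moreover have "p m + p m' \<in> K"
      using submodule_add[OF K] p_in[OF m(1)] p_in[OF m(2)] by simp
    ultimately show "p (m + m') = p m + p m'"
      by (intro p_eq)
  next
    fix r m
    assume m: "m \<in> ?N"
    have "r *l m - r *l p m \<in> X"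
      using submodule_scale[OF X, of "m - p m" r] p_in[OF m] by (simp add: scale_right_diff)
    moreover have "r *l p m \<in> K"
      using submodule_scale[OF K] p_in[OF m] by simp
    ultimately show "p (r *l m) = r *l p m"
      by (intro p_eq)
  qed
  with submodule_sum[OF X K] have "submodule ?N \<and> hom_on ?N p" ..
  then have "\<exists>g\<in>End. \<forall>m\<in>?N. g m = p m"
    using inj unfolding self_injective_def by (elim allE impE)
  then obtain g where g: "g \<in> End" and g_eq: "\<forall>m\<in>?N. g m = p m"
    by (elim bexE)
  have "g x = 0" if "x \<in> X" for x
  proof -
    have "x + 0 \<in> ?N"
      using that submodule_0[OF K] by blast
    then show ?thesis
      using bspec[OF g_eq, of "x + 0"] p_eq[of 0 x] that submodule_0[OF K] by simp
  qed
  moreover have "g k = k" if "k \<in> K" for k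
  proof -
    have "0 + k \<in> ?N"
      using that submodule_0[OF X] by blast
    then show ?thesis
      using bspec[OF g_eq, of "0 + k"] p_eq[of k k] that submodule_0[OF X] by simp
  qed
  ultimately show ?thesis
    using g by (auto simp: An_def)
qed

text \<open>
  If \<open>K\<close> meets \<open>X\<close> trivially, an endomorphism that kills \<open>X\<close> and fixes \<open>K\<close> is one
  of those in the intersection defining \<open>X \<odot> Y\<close>, and it maps \<open>K\<close> onto itself.
\<close>

lemma simple_imp_fully_coprime:
  assumes self_injective duo and K: "simple_submodule K"
  shows "fully_coprime K"
  unfolding fully_coprime_def
proof (intro conjI allI impI)
  show "fully_invariant K" "K \<noteq> {0}"
    using assms by (auto simp: simple_submodule_def duo_def)
next
  fix X Y
  assume "fully_invariant X \<and> fully_invariant Y" and cover: "K \<subseteq> X \<odot> Y"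
  then have X: "submodule X"
    by (simp add: fully_invariant_def)
  show "K \<subseteq> X \<or> K \<subseteq> Y"
  proof (cases "K \<subseteq> X")
    case False
    then have disj: "K \<inter> X = {0}"
      using simple_subset_iff_meets[OF K X] by blast
    have "submodule K"
      using K by (simp add: simple_submodule_def)
    from self_injective_extends_projection[OF assms(1) X this disj]
    obtain g where g: "g \<in> An X" "\<forall>k\<in>K. g k = k"
      by (elim bexE)
    have "k \<in> Y" if "k \<in> K" for k
    proof -
      have "k \<in> X \<odot> Y"
        using cover that by (rule subsetD)
      then have "g k \<in> Y"
        using g(1) by (simp add: coprod_def)
      then show ?thesis
        using g(2) that by simp
    qed
    then show ?thesis
      by blast
  qed simp
qed

section \<open>Separation and simplicity of the points\<close>

text \<open>
  Closed sets are downward closed among the points, so in a \<open>T\<^sub>1\<close> space distinct points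
  are incomparable; but atomicity puts a simple point below every point.
\<close>

lemma t1_imp_points_simple:
  assumes S_IAD and "t1_space Z_fc"
  shows "Spec_fc = simples"
proof
  have M: self_injective atomic duo
    using assms(1) by (simp_all add: S_IAD_def)
  show simples_points: "simples \<subseteq> Spec_fc"
    using simple_imp_fully_coprime[OF M(1,3)] by (auto simp: simples_def Spec_fc_def)
  show "Spec_fc \<subseteq> simples"
  proof
    fix K
    assume K: "K \<in> Spec_fc"
    then have "closedin Z_fc {K}"
      using assms(2) by (simp add: t1_space_closedin_singleton topspace_Z_fc[OF M(3)])
    then obtain L where L: "V_fc L = {K}"
      unfolding closedin_Z_fc[OF M(3)] by metis
    have "submodule K" "K \<noteq> {0}"
      using K by (simp_all add: Spec_fc_def fully_coprime_def fully_invariant_def)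
    then obtain S where S: "simple_submodule S" "S \<subseteq> K"
      using M(2) unfolding atomic_def by blast
    have "K \<in> V_fc L"
      by (simp add: L)
    then have "K \<subseteq> L"
      by (simp add: V_fc_def)
    then have "S \<in> V_fc L"
      using S simples_points by (auto simp: V_fc_def simples_def)
    then show "K \<in> simples"
      using S(1) L by (simp add: simples_def)
  qed
qed

text \<open>
  Simplicity of the points enters twice: it makes \<open>V_fc S = {S}\<close>, and it makes points
  compact with respect to unions of chains, as Zorn's lemma requires.
\<close>

lemma all_points_simple_imp_V_fc_exhausts:
  assumes duo and points: "Spec_fc = simples" and A: "A \<subseteq> Spec_fc"
  shows "\<exists>L. submodule L \<and> V_fc L = A"
proof -
  let ?\<F> = "{L. submodule L \<and> V_fc L \<subseteq> A}"
  have "?\<F> \<noteq> {}"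
    using submodule_zero V_fc_zero by blast
  moreover have "\<Union>\<C> \<in> ?\<F>" if "\<C> \<noteq> {}" "subset.chain ?\<F> \<C>" for \<C>
  proof -
    have mem: "submodule N" "V_fc N \<subseteq> A" if "N \<in> \<C>" for N
      using \<open>subset.chain ?\<F> \<C>\<close> that by (auto simp: subset_chain_def)
    have "submodule (\<Union>\<C>)"
      using submodule_chain_Union[OF \<open>\<C> \<noteq> {}\<close> mem(1)] \<open>subset.chain ?\<F> \<C>\<close>
      by (metis subset_chain_def)
    moreover have "K \<in> A" if "K \<in> V_fc (\<Union>\<C>)" for K
    proof -
      have K: "simple_submodule K" "K \<subseteq> \<Union>\<C>" "K \<in> Spec_fc"
        using that points by (auto simp: V_fc_def simples_def)
      obtain k where "k \<in> K" "k \<noteq> 0"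
        using K(1) submodule_0 unfolding simple_submodule_def by blast
      then obtain N where N: "N \<in> \<C>" "k \<in> N"
        using K(2) by blast
      then have "K \<subseteq> N"
        using simple_subset_iff_meets[OF K(1) mem(1)] \<open>k \<in> K\<close> \<open>k \<noteq> 0\<close> by blast
      then show ?thesis
        using mem(2)[OF N(1)] K(3) by (auto simp: V_fc_def)
    qed
    ultimately show ?thesis
      by blast
  qed
  ultimately have "\<exists>L\<in>?\<F>. \<forall>N\<in>?\<F>. L \<subseteq> N \<longrightarrow> N = L"
    by (rule subset_Zorn_nonempty)
  then obtain L where L: "submodule L" "V_fc L \<subseteq> A"
      and maximal: "\<And>N. submodule N \<Longrightarrow> V_fc N \<subseteq> A \<Longrightarrow> L \<subseteq> N \<Longrightarrow> N = L"
    by auto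
  have "S \<in> V_fc L" if "S \<in> A" for S
  proof -
    have S: "submodule S" "simple_submodule S" "S \<in> Spec_fc"
      using that A points by (auto simp: simples_def simple_submodule_def)
    have "V_fc S \<subseteq> {S}"
      using S(2) points by (auto simp: V_fc_def simples_def simple_submodule_def)
    then have "V_fc (L \<odot> S) \<subseteq> A"
      using V_fc_Un[OF assms(1) L(1) S(1)] L(2) that by blast
    moreover have "L \<subseteq> L \<odot> S"
      using submodule_0[OF S(1)] by (fastforce simp: coprod_def An_def)
    ultimately have "L \<odot> S = L"
      using maximal submodule_coprod[OF S(1)] by blast
    moreover have "S \<in> V_fc S"
      using S(3) by (simp add: V_fc_def)
    ultimately show ?thesis
      using V_fc_Un[OF assms(1) L(1) S(1)] by auto
  qed
  then show ?thesis
    using L by blast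
qed

lemma all_points_simple_imp_discrete:
  assumes duo and "Spec_fc = simples"
  shows "Z_fc = discrete_topology Spec_fc"
proof -
  have "openin Z_fc {K}" if "K \<in> Spec_fc" for K
  proof -
    obtain L where "submodule L" "V_fc L = Spec_fc - {K}"
      using all_points_simple_imp_V_fc_exhausts[OF assms, of "Spec_fc - {K}"] by blast
    moreover from this have "{K} = Spec_fc - V_fc L"
      using that by blast
    ultimately show ?thesis
      unfolding openin_Z_fc[OF assms(1)] by blast
  qed
  then show ?thesis
    using discrete_topology_unique[of Spec_fc Z_fc] topspace_Z_fc[OF assms(1)] by simp
qed

end

theorem theorem3p41:
  fixes scale :: "'r::ring_1 \<Rightarrow> 'm::ab_group_add \<Rightarrow> 'm"
  assumes "left_module scale"
    and "(UNIV :: 'm set) \<noteq> {0}"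
    and "left_module.S_IAD scale"
  shows "(left_module.Spec_fc scale = left_module.simples scale
            \<longleftrightarrow> left_module.Z_fc scale = discrete_topology (left_module.Spec_fc scale))
       \<and> (left_module.Z_fc scale = discrete_topology (left_module.Spec_fc scale)
            \<longleftrightarrow> Hausdorff_space (left_module.Z_fc scale))
       \<and> (Hausdorff_space (left_module.Z_fc scale)
            \<longleftrightarrow> t1_space (left_module.Z_fc scale))"
proof -
  interpret left_module scale
    by (rule assms(1))
  have "Spec_fc = simples \<Longrightarrow> Z_fc = discrete_topology Spec_fc"
    using all_points_simple_imp_discrete assms(3) by (simp add: S_IAD_def)
  moreover have "Z_fc = discrete_topology Spec_fc \<Longrightarrow> Hausdorff_space Z_fc"
    by (metis Hausdorff_space_discrete_topology)
  moreover have "Hausdorff_space Z_fc \<Longrightarrow> t1_space Z_fc"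
    by (rule Hausdorff_imp_t1_space)
  moreover have "t1_space Z_fc \<Longrightarrow> Spec_fc = simples"
    by (rule t1_imp_points_simple[OF assms(3)])
  ultimately show ?thesis
    by blast
qed

end
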